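(* Let $m\geq 3$ be an odd integer and let $p$, $p+2$ be a pair of twin primes (both prime). Then $p$ divides the class number of $\mathbb{Q}(\sqrt{1-2m^p})$ or $p+2$ divides the class number of $\mathbb{Q}(\sqrt{1-2m^{p+2}})$.
   Context: The class number of a number field is the order of its ideal class group. *)

theory Defs
  imports
    "HOL-Algebra.Algebra"
    "HOL-Algebra.Algebraic_Closure_Type"
    "HOL-Computational_Algebra.Computational_Algebra"
    Complex_Main
begin

abbreviation complex_ring :: "complex ring" where
  "complex_ring \<equiv> ring_of_type_algebra"

text \<open>Number fields are represented by their underlying subsets of the complex numbers.\<close>

definition quadratic_field :: "int \<Rightarrow> complex set" where
  "quadratic_field n = generate_field complex_ring (insert (csqrt (of_int n)) \<rat>)"

definition ring_of_integers :: "complex set \<Rightarrow> complex set" where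
  "ring_of_integers K = {x \<in> K. algebraic_int x}"

definition fractional_ideal :: "complex set \<Rightarrow> complex set \<Rightarrow> bool" where
  "fractional_ideal K I \<longleftrightarrow>
     I \<subseteq> K \<and> additive_subgroup I complex_ring \<and>
     (\<forall>a\<in>ring_of_integers K. \<forall>x\<in>I. a * x \<in> I) \<and>
     I \<noteq> {0} \<and>
     (\<exists>d\<in>ring_of_integers K - {0}. \<forall>x\<in>I. d * x \<in> ring_of_integers K)"

text \<open>Although the library introduces \<^const>\<open>ideal_prod\<close> for ideals of a ring, it is
  defined for arbitrary subsets, as the set of nonempty finite sums of products; taken in the
  ring of complex numbers, it is the usual product of fractional ideals.\<close>

definition fractional_ideal_group :: "complex set \<Rightarrow> complex set monoid" where
  "fractional_ideal_group K =
     \<lparr>carrier = {I. fractional_ideal K I},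
      monoid.mult = ideal_prod complex_ring,
      one = ring_of_integers K\<rparr>"

definition principal_fractional_ideals :: "complex set \<Rightarrow> complex set set" where
  "principal_fractional_ideals K =
     {(\<lambda>a. a * x) ` ring_of_integers K | x. x \<in> K - {0}}"

definition ideal_class_group :: "complex set \<Rightarrow> complex set set monoid" where
  "ideal_class_group K = fractional_ideal_group K Mod principal_fractional_ideals K"

text \<open>The ideal class group of a number field is finite, so the convention that infinite sets
  have cardinality 0 plays no role here.\<close>

definition class_number :: "complex set \<Rightarrow> nat" where
  "class_number K = Coset.order (ideal_class_group K)"

end

theory Submission
  imports Defs
begin

text \<open>Let \<open>n\<close> be an odd prime and \<open>D = 1 - 2 m ^ n\<close>. The element \<open>\<beta> = 1 - m ^ n + \<surd>D\<close> has norm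
  \<open>m ^ (2 n)\<close> and generates the \<open>n\<close>-th power of \<open>B = (m\<^sup>2, \<beta>)\<close>, so multiplication by \<open>B\<close> permutes
  the ideal classes with \<open>n\<close>-th iterate the identity. If \<open>n\<close> does not divide the class number,
  it fixes the class of some \<open>I\<close>, say \<open>B I = x I\<close>. Then \<open>\<beta> I = x ^ n I\<close>, so \<open>\<beta>\<close> is a unit times
  \<open>x ^ n\<close>. This avoids the invertibility of ideals and the finiteness of the class group (an
  infinite class group has order \<open>0\<close>, which \<open>n\<close> divides).

  Since the fourth powers of units are trivial, \<open>\<beta> = g ^ n\<close> for some \<open>g\<close>. With \<open>\<alpha> = 1 + \<surd>D\<close> we
  have \<open>\<alpha>\<^sup>2 = 2 \<beta>\<close>, so \<open>\<delta> = \<alpha> / g ^ ((n - 1) / 2)\<close> is integral with \<open>\<delta>\<^sup>2 = 2 g\<close> and norm \<open>2 m\<close>. Now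
  \<open>1 = Re \<alpha> = Re (\<delta> g ^ ((n - 1) / 2))\<close> is \<open>Re \<delta>\<close> times a term of an integral linear recurrence
  that depends only on \<open>m\<close> and \<open>Re \<delta>\<close>. Hence \<open>Re \<delta> = \<plusminus>1\<close> and the term is \<open>\<plusminus>1\<close>. For twin primes
  the two terms are consecutive, and the recurrence modulo \<open>m\<^sup>2\<close> excludes that both are \<open>\<plusminus>1\<close>.\<close>

section \<open>Preliminaries\<close>

text \<open>If \<open>q = a / b\<close> in lowest terms, every power of \<open>b\<close> divides the
  fixed nonzero integer \<open>c\<close>, which forces \<open>b = 1\<close>. Applied to norms, this
  turns a common denominator of all powers into integrality.\<close>

lemma Ints_if_power_multiples_Ints:
  fixes q c :: real
  assumes "q \<in> \<rat>" "c \<noteq> 0" and ints: "\<And>k::nat. c * q ^ k \<in> \<int>"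
  shows "q \<in> \<int>"
proof -
  obtain a b :: int where ab: "b > 0" "coprime a b" "q = of_int a / of_int b"
    using assms(1) by (auto elim: Rats_cases')
  obtain e :: int where e: "c = of_int e"
    using ints[of 0] by (auto elim: Ints_cases)
  have dvd: "b ^ k dvd e" for k
  proof -
    obtain f :: int where f: "c * q ^ k = of_int f"
      using ints[of k] by (auto elim: Ints_cases)
    have "of_int (e * a ^ k) = (of_int (f * b ^ k) :: real)"
      using f ab by (simp add: e power_divide field_simps)
    hence "b ^ k dvd e * a ^ k"
      by (metis of_int_eq_iff dvd_triv_right)
    moreover have "coprime (b ^ k) (a ^ k)"
      using ab(2) by (simp add: coprime_commute)
    ultimately show ?thesis
      by (simp add: coprime_dvd_mult_left_iff)
  qed
  have "b = 1"
  proof (rule ccontr)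
    assume "b \<noteq> 1"
    hence "b \<ge> 2" using ab(1) by simp
    define k where "k = nat \<bar>e\<bar>"
    have "(2::int) ^ k \<le> b ^ k"
      using \<open>b \<ge> 2\<close> by (intro power_mono) auto
    also have "b ^ k \<le> \<bar>e\<bar>"
      using dvd[of k] assms(2) e by (metis dvd_imp_le_int of_int_0 abs_of_pos ab(1) zero_less_power)
    also have "\<bar>e\<bar> = int k" by (simp add: k_def)
    also have "int k < 2 ^ k"
      using less_exp[of k] by (metis of_nat_less_iff of_nat_power of_nat_numeral)
    finally show False by simp
  qed
  thus ?thesis using ab by simp
qed

lemma square_int_real_Rats_Ints:
  fixes w :: real
  assumes "w \<in> \<rat>" "w\<^sup>2 \<in> \<int>"
  shows "w \<in> \<int>"
proof (rule rational_algebraic_int_is_int)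
  show "algebraic_int w"
    by (rule algebraic_int_root[of "w\<^sup>2" "monom 1 2"])
       (use assms in \<open>auto simp: poly_monom degree_monom_eq int_imp_algebraic_int\<close>)
qed fact

lemma Rats_complex_iff: "z \<in> (\<rat> :: complex set) \<longleftrightarrow> Im z = 0 \<and> Re z \<in> \<rat>"
proof
  assume "z \<in> \<rat>"
  thus "Im z = 0 \<and> Re z \<in> \<rat>"
    by (auto elim!: Rats_cases' simp: Re_divide Im_divide power2_eq_square)
next
  assume *: "Im z = 0 \<and> Re z \<in> \<rat>"
  hence "complex_of_real (Re z) \<in> \<rat>"
    by (auto elim!: Rats_cases')
  moreover have "complex_of_real (Re z) = z"
    using * by (simp add: complex_eq_iff)
  ultimately show "z \<in> \<rat>" by simp
qed

text \<open>Iterating \<open>f\<close> partitions \<open>S\<close> into orbits. Each orbit has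
  exactly \<open>n\<close> elements, because its length divides the prime \<open>n\<close> and is
  not 1.\<close>

lemma prime_dvd_card_if_no_fixed_point:
  fixes n :: nat and f :: "'a \<Rightarrow> 'a"
  assumes "Factorial_Ring.prime n" "finite S" "\<And>x. x \<in> S \<Longrightarrow> f x \<in> S"
    and period: "\<And>x. x \<in> S \<Longrightarrow> (f ^^ n) x = x" and no_fix: "\<And>x. x \<in> S \<Longrightarrow> f x \<noteq> x"
  shows "n dvd card S"
proof -
  define R where "R = {(x, (f ^^ k) x) | x k. x \<in> S}"
  have closed: "(f ^^ k) x \<in> S" if "x \<in> S" for k x
    by (induction k) (use that assms(3) in auto)
  have period_mult: "(f ^^ (n * k)) x = x" if "x \<in> S" for k x
    by (induction k) (use period that in \<open>simp_all add: funpow_add\<close>)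
  have n_pos: "n > 0" using assms(1) by (rule prime_gt_0_nat)
  have "equiv S R"
  proof (rule equivI)
    show "R \<subseteq> S \<times> S" using closed by (auto simp: R_def)
    show "refl_on S R"
      unfolding refl_on_def R_def by (auto intro: exI[of _ 0])
    show "sym R"
    proof (rule symI)
      fix x y assume "(x, y) \<in> R"
      then obtain k where k: "x \<in> S" "y = (f ^^ k) x" by (auto simp: R_def)
      \<comment> \<open>Since the \<open>n\<close>-th iterate is the identity,
        \<open>(n - 1) * k\<close> further steps undo \<open>k\<close> steps.\<close>
      have "(f ^^ ((n - 1) * k)) y = (f ^^ ((n - 1) * k + k)) x"
        by (simp add: k funpow_add)
      also have "(n - 1) * k + k = n * k"
        using n_pos by (cases n) auto
      finally have "(f ^^ ((n - 1) * k)) y = x" using k period_mult by simp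
      moreover have "y \<in> S" using k closed by simp
      ultimately show "(y, x) \<in> R" by (force simp: R_def)
    qed
    show "trans R"
    proof (rule transI)
      fix x y z assume "(x, y) \<in> R" "(y, z) \<in> R"
      then obtain k l where "x \<in> S" "y = (f ^^ k) x" "z = (f ^^ l) y" by (auto simp: R_def)
      hence "z = (f ^^ (l + k)) x" by (simp add: funpow_add)
      with \<open>x \<in> S\<close> show "(x, z) \<in> R" by (auto simp: R_def)
    qed
  qed
  moreover have "n dvd card C" if C_quot: "C \<in> S // R" for C
  proof -
    obtain x where x: "C = R `` {x}" "x \<in> S" using C_quot by (rule quotientE)
    have "(f ^^ k) x = (f ^^ (k mod n)) x" for k
    proof -
      have "(f ^^ k) x = (f ^^ (k mod n + n * (k div n))) x" by simp
      also have "\<dots> = (f ^^ (k mod n)) ((f ^^ (n * (k div n))) x)"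
        unfolding funpow_add by simp
      finally show ?thesis using x period_mult by simp
    qed
    hence C: "C = (\<lambda>k. (f ^^ k) x) ` {..<n}"
      using x n_pos by (fastforce simp: R_def)
    have "inj_on (\<lambda>k. (f ^^ k) x) {..<n}"
    proof (rule linorder_inj_onI)
      fix i j assume ij: "i < j" "j \<in> {..<n}"
      show "(f ^^ i) x \<noteq> (f ^^ j) x"
      proof
        assume "(f ^^ i) x = (f ^^ j) x"
        hence "(f ^^ (n - i)) ((f ^^ i) x) = (f ^^ (n - i)) ((f ^^ j) x)" by simp
        hence "(f ^^ (n - i + i)) x = (f ^^ (n - i + j)) x" by (simp add: funpow_add)
        moreover have "n - i + i = n" "n - i + j = (j - i) + n" using ij by auto
        ultimately have "x = (f ^^ (j - i)) ((f ^^ n) x)"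
          using period x by (metis comp_apply funpow_add)
        hence fix_ij: "(f ^^ (j - i)) x = x" using period x by simp
        have mult: "(f ^^ ((j - i) * k)) x = x" for k
          by (induction k) (use fix_ij in \<open>simp_all add: funpow_add\<close>)
        have "\<not> n dvd j - i" using ij by (auto dest: dvd_imp_le)
        hence "coprime (j - i) n"
          using assms(1) by (simp add: prime_imp_coprime coprime_commute)
        \<comment> \<open>By Bezout, some multiple of \<open>j - i\<close> exceeds a multiple of
          \<open>n\<close> by 1. The iterates of both orders fix \<open>x\<close>, so
          \<open>f\<close> itself would fix \<open>x\<close>.\<close>
        hence "\<exists>k l. (j - i) * k = n * l + 1"
          using ij bezout_nat[of "j - i" n] by (auto simp: coprime_iff_gcd_eq_1)
        then obtain k l where "(j - i) * k = n * l + 1" by blast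
        hence "f ((f ^^ (n * l)) x) = x" using mult[of k] by simp
        thus False using x period_mult no_fix by simp
      qed
    qed (auto simp: linear)
    thus ?thesis unfolding C by (simp add: card_image)
  qed
  ultimately show ?thesis
    by (rule equiv_imp_dvd_card[OF assms(2)])
qed

section \<open>The complex numbers as an algebraic structure\<close>

lemma complex_ring_simps [simp]:
  "carrier complex_ring = UNIV" "x \<otimes>\<^bsub>complex_ring\<^esub> y = x * y" "x \<oplus>\<^bsub>complex_ring\<^esub> y = x + y"
  "\<one>\<^bsub>complex_ring\<^esub> = 1" "\<zero>\<^bsub>complex_ring\<^esub> = 0"
  by (simp_all add: ring_of_type_algebra_def)

lemma complex_ring_a_inv [simp]: "\<ominus>\<^bsub>complex_ring\<^esub> x = - x"
  unfolding a_inv_def m_inv_def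
  by (rule the_equality) (simp_all add: ring_of_type_algebra_def eq_neg_iff_add_eq_0)

lemma complex_ring_m_inv [simp]:
  assumes "x \<noteq> 0"
  shows "inv\<^bsub>complex_ring\<^esub> x = inverse x"
  unfolding m_inv_def
  by (rule the_equality) (use assms in \<open>auto dest: inverse_unique\<close>)

section \<open>Integers of an imaginary quadratic field\<close>

text \<open>\<open>D\<close> may have square factors, so the ring of integers can be larger than
  Z[sqrt D]. The congruence still makes the real parts of its elements integral.\<close>

locale imaginary_quadratic =
  fixes D :: int
  assumes D_neg: "D < 0" and D_mod_4: "D mod 4 = 3"
begin

definition r :: real where "r = sqrt (- of_int D)"

abbreviation K :: "complex set" where "K \<equiv> quadratic_field D"
abbreviation \<O> :: "complex set" where "\<O> \<equiv> ring_of_integers K"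

lemma r_pos: "r > 0" and r_square: "r * r = - of_int D"
  using D_neg by (auto simp: r_def)

lemma csqrt_D: "csqrt (of_int D) = \<i> * r"
proof -
  have "csqrt (of_real (- (r * r))) = \<i> * r"
    using r_pos by (simp add: csqrt_of_real_nonpos real_sqrt_mult del: of_real_mult of_real_minus)
  thus ?thesis by (simp add: r_square)
qed

lemma Im_mult_Im_Rats:
  assumes "Im x * r \<in> \<rat>" "Im y * r \<in> \<rat>"
  shows "Im x * Im y \<in> \<rat>"
proof -
  have "(Im x * r) * (Im y * r) / (- of_int D) \<in> \<rat>"
    by (intro Rats_divide Rats_mult[OF assms]) auto
  also have "(Im x * r) * (Im y * r) / (- of_int D) = Im x * Im y"
    using r_pos unfolding r_square [symmetric] by (simp add: divide_simps)
  finally show ?thesis .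
qed

text \<open>For \<open>z = a + b * sqrt D\<close> with rational \<open>a\<close> and
  \<open>b\<close>, the number \<open>Im z * r\<close> is \<open>- D * b\<close>, so membership
  becomes a condition on two real numbers. These conditions are preserved by the field operations;
  conversely, \<open>b\<close> is recovered as \<open>Im z * r / (r * r)\<close>.\<close>

lemma mem_K_iff: "z \<in> K \<longleftrightarrow> Re z \<in> \<rat> \<and> Im z * r \<in> \<rat>"
proof
  define E where "E = {z. Re z \<in> \<rat> \<and> Im z * r \<in> \<rat>}"
  assume "z \<in> K"
  hence "z \<in> generate_field complex_ring (insert (\<i> * r) \<rat>)"
    by (simp add: quadratic_field_def csqrt_D)
  hence "z \<in> E"
  proof induction
    case one
    show ?case by (simp add: E_def)
  next
    case (incl h)
    thus ?case by (auto simp: E_def Rats_complex_iff r_square)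
  next
    case (a_inv h)
    thus ?case by (auto simp: E_def)
  next
    case (m_inv h)
    have "Im h * Im h \<in> \<rat>"
      using m_inv by (auto simp: E_def intro: Im_mult_Im_Rats)
    hence "inverse ((Re h)\<^sup>2 + (Im h)\<^sup>2) \<in> \<rat>"
      using m_inv by (auto simp: E_def power2_eq_square)
    hence "Re h * inverse ((Re h)\<^sup>2 + (Im h)\<^sup>2) \<in> \<rat>"
          "- ((Im h * r) * inverse ((Re h)\<^sup>2 + (Im h)\<^sup>2)) \<in> \<rat>"
      using m_inv by (auto simp: E_def intro!: Rats_mult)
    thus ?case using m_inv by (simp add: E_def divide_inverse mult_ac)
  next
    case (eng_add h1 h2)
    thus ?case by (auto simp: E_def algebra_simps)
  next
    case (eng_mult h1 h2)
    have "Im h1 * Im h2 \<in> \<rat>"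
      using eng_mult by (auto simp: E_def intro: Im_mult_Im_Rats)
    moreover have "Re h1 * (Im h2 * r) + (Im h1 * r) * Re h2 \<in> \<rat>"
      using eng_mult by (auto simp: E_def)
    ultimately show ?case using eng_mult by (auto simp: E_def algebra_simps)
  qed
  thus "Re z \<in> \<rat> \<and> Im z * r \<in> \<rat>" by (simp add: E_def)
next
  assume *: "Re z \<in> \<rat> \<and> Im z * r \<in> \<rat>"
  define G where "G = generate_field complex_ring (insert (\<i> * r) \<rat>)"
  have add: "x + y \<in> G" and mult: "x * y \<in> G" if "x \<in> G" "y \<in> G" for x y
    using that generate_field.eng_add[of x complex_ring _ y]
      generate_field.eng_mult[of x complex_ring _ y] by (auto simp: G_def)
  have "inverse (r * r) \<in> \<rat>" by (simp add: r_square)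
  hence "of_real (Re z) \<in> G" "of_real ((Im z * r) * inverse (r * r)) \<in> G" "\<i> * r \<in> G"
    using * Rats_mult[of "Im z * r" "inverse (r * r)"] unfolding G_def
    by (auto intro!: generate_field.incl simp: Rats_complex_iff simp del: inverse_mult_distrib of_real_mult)
  hence "of_real (Re z) + of_real ((Im z * r) * inverse (r * r)) * (\<i> * r) \<in> G"
    by (intro add mult[of "of_real _"])
  also have "of_real (Re z) + of_real ((Im z * r) * inverse (r * r)) * (\<i> * r) = z"
    using r_pos by (simp add: complex_eq_iff divide_simps)
  finally show "z \<in> K"
    by (simp add: G_def quadratic_field_def csqrt_D)
qed

lemma
  shows K_1: "1 \<in> K" and K_of_int: "of_int i \<in> K"
    and K_add: "x \<in> K \<Longrightarrow> y \<in> K \<Longrightarrow> x + y \<in> K"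
    and K_mult: "x \<in> K \<Longrightarrow> y \<in> K \<Longrightarrow> x * y \<in> K"
    and K_inverse: "x \<in> K \<Longrightarrow> inverse x \<in> K"
proof -
  have "0 \<in> K" by (simp add: mem_K_iff)
  show "1 \<in> K" "of_int i \<in> K"
    by (simp_all add: mem_K_iff)
  show "x \<in> K \<Longrightarrow> y \<in> K \<Longrightarrow> x + y \<in> K" "x \<in> K \<Longrightarrow> y \<in> K \<Longrightarrow> x * y \<in> K"
    using generate_field.eng_add[of x complex_ring _ y]
      generate_field.eng_mult[of x complex_ring _ y]
    by (auto simp: quadratic_field_def)
  show "x \<in> K \<Longrightarrow> inverse x \<in> K"
    using generate_field.m_inv[of x complex_ring] \<open>0 \<in> K\<close>
    by (cases "x = 0") (auto simp: quadratic_field_def)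
qed

lemma K_divide: "x \<in> K \<Longrightarrow> y \<in> K \<Longrightarrow> x / y \<in> K"
  by (simp add: divide_inverse K_mult K_inverse)

lemma K_power: "x \<in> K \<Longrightarrow> x ^ k \<in> K"
  by (induction k) (auto intro: K_1 K_mult)

lemma norm_K_Rats: "z \<in> K \<Longrightarrow> (cmod z)\<^sup>2 \<in> \<rat>"
  unfolding mem_K_iff cmod_power2 using Im_mult_Im_Rats[of z z] by (simp add: power2_eq_square)

section \<open>Common denominators of powers and integrality of norms\<close>

text \<open>This is Z + Z / sqrt D, on which norms have denominators dividing the fixed number
  \<open>D\<close>.\<close>

definition lattice :: "complex set" where
  "lattice = {w. Re w \<in> \<int> \<and> Im w * r \<in> \<int>}"

lemma lattice_norm: "w \<in> lattice \<Longrightarrow> - of_int D * (cmod w)\<^sup>2 \<in> \<int>"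
proof -
  assume "w \<in> lattice"
  moreover have "- of_int D * (cmod w)\<^sup>2 = - of_int D * (Re w)\<^sup>2 + (Im w * r)\<^sup>2"
    unfolding cmod_power2 by (simp add: power_mult_distrib r_square [symmetric] power2_eq_square algebra_simps)
  ultimately show ?thesis by (auto simp: lattice_def)
qed

lemma powers_common_denominator:
  assumes "z \<in> K"
  shows "\<exists>c::int. c > 0 \<and> (\<forall>k<n. of_int c * z ^ k \<in> lattice)"
proof (induction n)
  case (Suc n)
  then obtain c :: int where c: "c > 0" "\<forall>k<n. of_int c * z ^ k \<in> lattice" by blast
  have "z ^ n \<in> K" using assms by (rule K_power)
  then obtain a b a' b' :: int where
    ab: "b > 0" "Re (z ^ n) = of_int a / of_int b" "b' > 0" "Im (z ^ n) * r = of_int a' / of_int b'"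
    unfolding mem_K_iff by (metis Rats_cases')
  have "Re (of_int (c * b * b') * z ^ n) = of_int (c * b' * a)"
    using ab by simp
  moreover have "Im (of_int (c * b * b') * z ^ n) * r = of_int (c * b) * (of_int b' * (Im (z ^ n) * r))"
    by simp
  hence "Im (of_int (c * b * b') * z ^ n) * r = of_int (c * b * a')"
    unfolding ab using ab by simp
  ultimately have n: "of_int (c * b * b') * z ^ n \<in> lattice"
    unfolding lattice_def by (metis (mono_tags, lifting) Ints_of_int mem_Collect_eq)
  have "of_int (c * b * b') * z ^ k \<in> lattice" if "k < n" for k
  proof -
    have "of_int (b * b') * Re (of_int c * z ^ k) \<in> \<int>"
         "of_int (b * b') * (Im (of_int c * z ^ k) * r) \<in> \<int>"
      using c(2) that by (auto simp: lattice_def intro!: Ints_mult simp del: of_int_mult)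
    thus ?thesis by (simp add: lattice_def mult_ac)
  qed
  with n have "\<forall>k<Suc n. of_int (c * b * b') * z ^ k \<in> lattice"
    by (auto simp: less_Suc_eq)
  thus ?case using c(1) ab by (intro exI[of _ "c * b * b'"]) auto
qed (auto intro: exI[of _ 1])

text \<open>The monic equation reduces every power of \<open>z\<close> to integral combinations of
  the powers below its degree, so a common denominator \<open>c\<close> of these serves all powers.
  Hence all powers of the norm have denominators dividing \<open>D * c\<^sup>2\<close>.\<close>

lemma algebraic_int_norm_Ints:
  assumes "z \<in> K" "algebraic_int z"
  shows "(cmod z)\<^sup>2 \<in> \<int>"
proof -
  obtain p where p: "poly (map_poly of_int p) z = 0" "lead_coeff p = 1"
    using assms(2) by (auto simp: algebraic_int_altdef_ipoly)
  define n where "n = degree p"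
  have "(\<Sum>i\<le>n. of_int (coeff p i) * z ^ i) = 0"
    using p by (simp add: poly_altdef n_def degree_map_poly coeff_map_poly)
  hence zn: "z ^ n = - (\<Sum>i<n. of_int (coeff p i) * z ^ i)"
    using p(2) by (simp add: n_def lessThan_Suc_atMost [symmetric] eq_neg_iff_add_eq_0 add.commute)
  obtain c :: int where c: "c > 0" "\<forall>k<n. of_int c * z ^ k \<in> lattice"
    using powers_common_denominator[OF assms(1)] by blast
  have c': "of_int c * z ^ k \<in> lattice" for k
  proof (induction k rule: less_induct)
    case (less k)
    show ?case
    proof (cases "k < n")
      case False
      have "of_int c * z ^ k = of_int c * z ^ (k - n) * z ^ n"
        using False by (simp add: mult.assoc power_add [symmetric])
      also have "\<dots> = (\<Sum>i<n. of_int (- coeff p i) * (of_int c * z ^ (k - n + i)))"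
        unfolding zn by (simp add: sum_distrib_left power_add sum_negf mult_ac)
      finally have eq: "of_int c * z ^ k = \<dots>" .
      have "of_int c * z ^ (k - n + i) \<in> lattice" if "i < n" for i
        using less.IH False that by simp
      thus ?thesis
        unfolding eq lattice_def
        by (auto simp: sum_distrib_right mult.assoc intro!: Ints_sum Ints_mult Ints_diff)
    qed (use c in auto)
  qed
  show ?thesis
  proof (rule Ints_if_power_multiples_Ints)
    show "(cmod z)\<^sup>2 \<in> \<rat>" using assms(1) by (rule norm_K_Rats)
    show "- of_int D * (of_int c)\<^sup>2 \<noteq> (0::real)"
      using D_neg c by simp
    show "- of_int D * (of_int c)\<^sup>2 * ((cmod z)\<^sup>2) ^ k \<in> \<int>" for k
      using lattice_norm[OF c'[of k]]
      by (simp add: norm_mult norm_power power_mult_distrib power_mult [symmetric] mult.commute mult.left_commute)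
  qed
qed

text \<open>The norms of \<open>z\<close> and \<open>z + 1\<close> determine the trace
  \<open>t = 2 * Re z\<close>, which is thus an integer. If it were odd, the integral square
  \<open>(2 * (Im z * r))\<^sup>2\<close> would be congruent to \<open>t\<^sup>2 * D\<close>, that
  is to 3, modulo 4.\<close>

lemma norm_Ints_imp_Re_Ints:
  assumes "z \<in> K" "(cmod z)\<^sup>2 \<in> \<int>" "(cmod (z + 1))\<^sup>2 \<in> \<int>"
  shows "Re z \<in> \<int>"
proof -
  have "(cmod (z + 1))\<^sup>2 - (cmod z)\<^sup>2 - 1 \<in> \<int>" using assms by auto
  also have "(cmod (z + 1))\<^sup>2 - (cmod z)\<^sup>2 - 1 = 2 * Re z"
    unfolding cmod_power2 by (simp add: power2_eq_square algebra_simps)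
  finally obtain t where t: "2 * Re z = of_int t" by (auto elim: Ints_cases)
  obtain N where N: "(cmod z)\<^sup>2 = of_int N" using assms by (auto elim: Ints_cases)
  have "(2 * (Im z * r))\<^sup>2 = (4 * (cmod z)\<^sup>2 - (2 * Re z)\<^sup>2) * (r * r)"
    unfolding cmod_power2 by (simp add: power2_eq_square algebra_simps)
  also have "\<dots> = of_int ((4 * N - t\<^sup>2) * (- D))"
    unfolding t N r_square by simp
  finally have sq: "(2 * (Im z * r))\<^sup>2 = of_int ((4 * N - t\<^sup>2) * (- D))" .
  have "2 * (Im z * r) \<in> \<rat>" using assms(1) by (simp add: mem_K_iff)
  hence "2 * (Im z * r) \<in> \<int>"
    by (rule square_int_real_Rats_Ints) (unfold sq, rule Ints_of_int)
  then obtain w where "2 * (Im z * r) = of_int w" by (auto elim: Ints_cases)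
  with sq have w: "w\<^sup>2 = (4 * N - t\<^sup>2) * (- D)"
    by (metis of_int_eq_iff of_int_power)
  have "even t"
  proof (rule ccontr)
    assume "odd t"
    then obtain a where a: "t = 2 * a + 1" by (elim oddE)
    obtain e where e: "D = 4 * e + 3"
      using D_mod_4 by (metis mult.commute div_mult_mod_eq)
    have "w\<^sup>2 = 3 + 4 * ((a * a + a - N) * (4 * e + 3) + e)"
      unfolding w a e by (simp add: power2_eq_square algebra_simps)
    hence "w\<^sup>2 mod 4 = 3" by (simp only: mod_mult_self2) simp
    moreover have "w\<^sup>2 mod 4 = 0 \<or> w\<^sup>2 mod 4 = 1"
    proof (cases "even w")
      case True
      then obtain b where "w = 2 * b" by blast
      thus ?thesis by (simp add: power2_eq_square)
    next
      case False
      then obtain b where "w = 2 * b + 1" by (elim oddE)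
      hence "w\<^sup>2 = 4 * (b * b + b) + 1" by (simp add: power2_eq_square algebra_simps)
      thus ?thesis by presburger
    qed
    ultimately show False by simp
  qed
  then obtain t' where "t = 2 * t'" by blast
  thus ?thesis using t by simp
qed

text \<open>If \<open>z\<close> is integral, so is \<open>z + 1\<close>, and their two norms give
  the real part. Conversely, \<open>z\<close> is a root of the monic quadratic polynomial with trace
  \<open>2 * Re z\<close> and constant term \<open>(cmod z)\<^sup>2\<close>.\<close>

lemma mem_\<O>_iff: "z \<in> \<O> \<longleftrightarrow> z \<in> K \<and> Re z \<in> \<int> \<and> (cmod z)\<^sup>2 \<in> \<int>"
proof safe
  assume "z \<in> \<O>"
  hence z: "z \<in> K" "algebraic_int z" by (auto simp: ring_of_integers_def)
  show "z \<in> K" by fact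
  show norm: "(cmod z)\<^sup>2 \<in> \<int>" using z by (rule algebraic_int_norm_Ints)
  have "algebraic_int (z + 1)"
    by (rule algebraic_int_root[of z "[:-1, 1:]"]) (use z in \<open>auto simp: coeff_pCons split: nat.splits\<close>)
  hence "(cmod (z + 1))\<^sup>2 \<in> \<int>" using z by (intro algebraic_int_norm_Ints K_add K_1)
  with z norm show "Re z \<in> \<int>" by (intro norm_Ints_imp_Re_Ints)
next
  assume z: "z \<in> K" "Re z \<in> \<int>" "(cmod z)\<^sup>2 \<in> \<int>"
  have "algebraic_int z"
  proof
    let ?p = "[:of_real ((cmod z)\<^sup>2), of_real (- 2 * Re z), 1:] :: complex poly"
    show "lead_coeff ?p = 1" by simp
    show "\<forall>i. coeff ?p i \<in> \<int>"
      using z(2,3) by (auto simp: coeff_pCons elim!: Ints_cases simp del: of_real_power split: nat.splits)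
    show "poly ?p z = 0"
      unfolding cmod_power2 by (simp add: complex_eq_iff power2_eq_square algebra_simps)
  qed
  with z show "z \<in> \<O>" by (simp add: ring_of_integers_def)
qed

lemma \<O>_subset_K: "z \<in> \<O> \<Longrightarrow> z \<in> K"
  by (simp add: mem_\<O>_iff)

lemma \<O>_of_int: "of_int i \<in> \<O>"
  by (simp add: mem_\<O>_iff K_of_int cmod_power2)

lemma \<O>_1: "1 \<in> \<O>"
  using \<O>_of_int[of 1] by simp

text \<open>Each \<open>(Im z)\<^sup>2\<close> is the norm minus the square of the real part, so the
  rational number \<open>Im x * Im y\<close> has an integral square. This makes
  \<open>Re (x * y)\<close> integral and so yields closure under products.\<close>

lemma \<O>_Im_mult_Im:
  assumes "x \<in> \<O>" "y \<in> \<O>"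
  shows "Im x * Im y \<in> \<int>"
proof (rule square_int_real_Rats_Ints)
  have Im: "(Im z)\<^sup>2 \<in> \<int>" if "z \<in> \<O>" for z
  proof -
    have "(cmod z)\<^sup>2 - (Re z)\<^sup>2 \<in> \<int>" using that by (simp add: mem_\<O>_iff)
    thus ?thesis by (simp add: cmod_power2)
  qed
  show "(Im x * Im y)\<^sup>2 \<in> \<int>"
    using Im[OF assms(1)] Im[OF assms(2)] by (simp add: power_mult_distrib)
  show "Im x * Im y \<in> \<rat>"
    using assms by (auto simp: mem_\<O>_iff mem_K_iff intro: Im_mult_Im_Rats)
qed

lemma \<O>_mult: "x \<in> \<O> \<Longrightarrow> y \<in> \<O> \<Longrightarrow> x * y \<in> \<O>"
  using \<O>_Im_mult_Im[of x y]
  by (simp add: mem_\<O>_iff K_mult norm_mult power_mult_distrib)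

lemma \<O>_power: "x \<in> \<O> \<Longrightarrow> x ^ k \<in> \<O>"
  by (induction k) (auto intro: \<O>_1 \<O>_mult)


section \<open>Ideal classes\<close>

lemma fractional_ideal_iff:
  "fractional_ideal K I \<longleftrightarrow> I \<subseteq> K \<and> 0 \<in> I \<and> (\<forall>x\<in>I. \<forall>y\<in>I. x + y \<in> I) \<and>
     (\<forall>a\<in>\<O>. \<forall>x\<in>I. a * x \<in> I) \<and> I \<noteq> {0} \<and> (\<exists>d\<in>\<O> - {0}. \<forall>x\<in>I. d * x \<in> \<O>)"
proof -
  have neg: "- x \<in> I" if "\<forall>a\<in>\<O>. \<forall>x\<in>I. a * x \<in> I" "x \<in> I" for x
    using that \<O>_of_int[of "-1"] by force
  have "additive_subgroup I complex_ring \<longleftrightarrow>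
      0 \<in> I \<and> (\<forall>x\<in>I. \<forall>y\<in>I. x + y \<in> I) \<and> (\<forall>x\<in>I. - x \<in> I)"
    unfolding additive_subgroup_def subgroup_def a_inv_def [symmetric] complex_ring_a_inv
    by (auto simp: a_inv_def [symmetric])
  thus ?thesis unfolding fractional_ideal_def using neg by blast
qed

lemma
  assumes "fractional_ideal K I"
  shows fractional_ideal_add: "x \<in> I \<Longrightarrow> y \<in> I \<Longrightarrow> x + y \<in> I"
    and fractional_ideal_mult: "a \<in> \<O> \<Longrightarrow> x \<in> I \<Longrightarrow> a * x \<in> I"
    and fractional_ideal_0: "0 \<in> I"
    and fractional_ideal_subset: "x \<in> I \<Longrightarrow> x \<in> K"
  using assms unfolding fractional_ideal_iff by (simp_all add: subset_iff)

lemma fractional_ideal_nonzero_elem: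
  assumes "fractional_ideal K I"
  obtains y where "y \<in> I" "y \<noteq> 0"
  using assms unfolding fractional_ideal_iff by blast

text \<open>In place of the determinant argument for finitely generated modules: the powers of \<open>x\<close>
  have a common denominator, hence so do their norms.\<close>

lemma fractional_ideal_stabilizer:
  assumes I: "fractional_ideal K I" and "x \<in> K" and stable: "\<And>y. y \<in> I \<Longrightarrow> x * y \<in> I"
  shows "x \<in> \<O>"
proof -
  obtain d where d: "d \<in> \<O>" "d \<noteq> 0" "\<And>y. y \<in> I \<Longrightarrow> d * y \<in> \<O>"
    using I unfolding fractional_ideal_iff by blast
  obtain y where y: "y \<in> I" "y \<noteq> 0" using I by (rule fractional_ideal_nonzero_elem)
  have norm: "(cmod x)\<^sup>2 \<in> \<int>" if x: "x \<in> K" "\<And>y. y \<in> I \<Longrightarrow> x * y \<in> I" for x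
  proof (rule Ints_if_power_multiples_Ints)
    show "(cmod x)\<^sup>2 \<in> \<rat>" using x(1) by (rule norm_K_Rats)
    \<comment> \<open>Since \<open>d * (x ^ k * y)\<close> is integral for every \<open>k\<close>,
      the norm of \<open>d * y\<close> clears the denominators of all powers of the norm of
      \<open>x\<close>.\<close>
    show "(cmod (d * y))\<^sup>2 \<noteq> 0" using d y by simp
    show "(cmod (d * y))\<^sup>2 * ((cmod x)\<^sup>2) ^ k \<in> \<int>" for k
    proof -
      have "x ^ k * y \<in> I" by (induction k) (use x(2) y in \<open>simp_all add: mult.assoc\<close>)
      hence "d * (x ^ k * y) \<in> \<O>" by (rule d)
      hence "(cmod (d * (x ^ k * y)))\<^sup>2 \<in> \<int>" by (simp add: mem_\<O>_iff)
      thus ?thesis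
        by (simp add: norm_mult norm_power power_mult_distrib power_mult [symmetric] mult_ac)
    qed
  qed
  \<comment> \<open>As \<open>x + 1\<close> also stabilizes \<open>I\<close>, its norm is integral
    too, and the two norms make \<open>Re x\<close> integral.\<close>
  have "(x + 1) * y \<in> I" if "y \<in> I" for y
    using that stable fractional_ideal_add[OF I] by (simp add: distrib_right)
  thus ?thesis
    using assms(2) norm stable by (auto simp: mem_\<O>_iff intro!: norm_Ints_imp_Re_Ints K_add K_1)
qed

section \<open>Ideal classes as sets of scaled ideals\<close>

definition ideal_class :: "complex set \<Rightarrow> complex set set" where
  "ideal_class I = {(*) x ` I | x. x \<in> K - {0}}"

lemma ideal_prod_principal:
  assumes I: "fractional_ideal K I"
  shows "ideal_prod complex_ring ((\<lambda>a. a * x) ` \<O>) I = (*) x ` I"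
proof (intro equalityI subsetI)
  fix z assume "z \<in> ideal_prod complex_ring ((\<lambda>a. a * x) ` \<O>) I"
  thus "z \<in> (*) x ` I"
  proof induction
    case (prod i j)
    then obtain a where "a \<in> \<O>" "i = a * x" by blast
    hence "i * j = x * (a * j)" "a * j \<in> I"
      using prod fractional_ideal_mult[OF I] by simp_all
    thus ?case by auto
  next
    case (sum s1 s2)
    then obtain y1 y2 where "s1 = x * y1" "y1 \<in> I" "s2 = x * y2" "y2 \<in> I" by blast
    hence "s1 + s2 = x * (y1 + y2)" "y1 + y2 \<in> I"
      using fractional_ideal_add[OF I] by (simp_all add: algebra_simps)
    thus ?case by auto
  qed
next
  fix z assume "z \<in> (*) x ` I"
  then obtain y where y: "z = x * y" "y \<in> I" by blast
  have "x \<in> (\<lambda>a. a * x) ` \<O>" using \<O>_1 by (force intro: image_eqI[of _ _ 1])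
  hence "x \<otimes>\<^bsub>complex_ring\<^esub> y \<in> ideal_prod complex_ring ((\<lambda>a. a * x) ` \<O>) I"
    using y by (intro ideal_prod.prod)
  thus "z \<in> ideal_prod complex_ring ((\<lambda>a. a * x) ` \<O>) I" using y by simp
qed

text \<open>The order of the quotient depends only on its carrier, the set of cosets of the
  principal ideals. By \<open>ideal_prod_principal\<close>, the coset of \<open>I\<close> is
  \<open>ideal_class I\<close>.\<close>

lemma class_number_eq: "class_number K = card (ideal_class ` Collect (fractional_ideal K))"
proof -
  have "principal_fractional_ideals K #>\<^bsub>fractional_ideal_group K\<^esub> I = ideal_class I"
    if "fractional_ideal K I" for I
    using ideal_prod_principal[OF that]
    unfolding r_coset_def ideal_class_def principal_fractional_ideals_def fractional_ideal_group_def
    by auto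
  hence "carrier (ideal_class_group K) = ideal_class ` Collect (fractional_ideal K)"
    unfolding ideal_class_group_def FactGroup_def RCOSETS_def
    by (auto simp: fractional_ideal_group_def)
  thus ?thesis by (simp add: class_number_def Coset.order_def)
qed

lemma mem_ideal_class_self: "I \<in> ideal_class I"
proof -
  have "I = (*) 1 ` I \<and> 1 \<in> K - {0}" using K_1 by simp
  thus ?thesis unfolding ideal_class_def mem_Collect_eq by (rule exI)
qed

lemma ideal_class_scale:
  assumes "x \<in> K" "x \<noteq> 0"
  shows "ideal_class ((*) x ` I) = ideal_class I"
proof
  show "ideal_class ((*) x ` I) \<subseteq> ideal_class I"
  proof
    fix J assume "J \<in> ideal_class ((*) x ` I)"
    then obtain y where "y \<in> K - {0}" "J = (*) (y * x) ` I"
      by (auto simp: ideal_class_def image_image mult.assoc)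
    moreover from this have "y * x \<in> K - {0}" using assms by (simp add: K_mult)
    ultimately show "J \<in> ideal_class I" unfolding ideal_class_def by blast
  qed
  show "ideal_class I \<subseteq> ideal_class ((*) x ` I)"
  proof
    fix J assume "J \<in> ideal_class I"
    then obtain y where y: "y \<in> K - {0}" "J = (*) y ` I"
      by (auto simp: ideal_class_def)
    hence "J = (*) (y / x) ` (*) x ` I" using assms by (simp add: image_image)
    moreover have "y / x \<in> K - {0}" using y assms by (simp add: K_divide)
    ultimately show "J \<in> ideal_class ((*) x ` I)" unfolding ideal_class_def by blast
  qed
qed

section \<open>Multiplication by an ideal with two generators\<close>

definition two_gen :: "complex \<Rightarrow> complex \<Rightarrow> complex set \<Rightarrow> complex set" where
  "two_gen a b I = {a * x + b * y | x y. x \<in> I \<and> y \<in> I}"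

lemma two_gen_scale: "two_gen a b ((*) c ` I) = (*) c ` two_gen a b I"
proof -
  have "a * (c * x) + b * (c * y) = c * (a * x + b * y)" for x y
    by (simp add: algebra_simps)
  thus ?thesis unfolding two_gen_def by (auto simp: image_iff) (metis+)
qed

text \<open>Multiplication by \<open>(a, b)\<close> commutes with scaling, so taking images under it
  defines a map on ideal classes.\<close>

lemma two_gen_ideal_class: "two_gen a b ` ideal_class I = ideal_class (two_gen a b I)"
proof -
  have "two_gen a b ` (\<lambda>c. (*) c ` I) ` (K - {0}) = (\<lambda>c. (*) c ` two_gen a b I) ` (K - {0})"
    by (simp only: image_image two_gen_scale [symmetric])
  moreover have "ideal_class J = (\<lambda>c. (*) c ` J) ` (K - {0})" for J
    unfolding ideal_class_def by blast
  ultimately show ?thesis by simp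
qed

lemma fractional_ideal_two_gen:
  assumes I: "fractional_ideal K I" and ab: "a \<in> \<O>" "b \<in> \<O>" "a \<noteq> 0"
  shows "fractional_ideal K (two_gen a b I)"
proof -
  have sub: "two_gen a b I \<subseteq> I"
    using fractional_ideal_add[OF I] fractional_ideal_mult[OF I] ab by (auto simp: two_gen_def)
  obtain y where y: "y \<in> I" "y \<noteq> 0" using I by (rule fractional_ideal_nonzero_elem)
  have "a * y + b * 0 \<in> two_gen a b I"
    using y fractional_ideal_0[OF I] unfolding two_gen_def by blast
  moreover have "a * y + b * 0 \<noteq> 0" using y ab by simp
  ultimately have "two_gen a b I \<noteq> {0}" by blast
  moreover have "0 \<in> two_gen a b I"
    using fractional_ideal_0[OF I] unfolding two_gen_def by force
  moreover have "c * z \<in> two_gen a b I" if cz: "c \<in> \<O>" "z \<in> two_gen a b I" for c z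
  proof -
    obtain x y where xy: "z = a * x + b * y" "x \<in> I" "y \<in> I"
      using cz by (auto simp: two_gen_def)
    have "c * z = a * (c * x) + b * (c * y)" by (simp add: xy algebra_simps)
    thus ?thesis using xy cz fractional_ideal_mult[OF I] unfolding two_gen_def by blast
  qed
  moreover have "z + w \<in> two_gen a b I" if zw: "z \<in> two_gen a b I" "w \<in> two_gen a b I" for z w
  proof -
    obtain x y x' y' where xy: "z = a * x + b * y" "x \<in> I" "y \<in> I"
        "w = a * x' + b * y'" "x' \<in> I" "y' \<in> I"
      using zw by (auto simp: two_gen_def)
    have "z + w = a * (x + x') + b * (y + y')" by (simp add: xy algebra_simps)
    thus ?thesis using xy fractional_ideal_add[OF I] unfolding two_gen_def by blast
  qed
  moreover have "two_gen a b I \<subseteq> K" using sub fractional_ideal_subset[OF I] by blast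
  moreover have "\<exists>d\<in>\<O> - {0}. \<forall>x\<in>two_gen a b I. d * x \<in> \<O>"
    using I sub unfolding fractional_ideal_iff by (meson subsetD)
  ultimately show ?thesis
    unfolding fractional_ideal_iff by simp
qed

text \<open>Since \<open>two_gen a b I\<close> is the product of \<open>I\<close> with the ideal \<open>(a, b)\<close>, this says that
  \<open>(a, b) ^ j = (a ^ j, b)\<close> if \<open>b\<close> has norm \<open>a ^ n\<close> and its trace \<open>t\<close> is prime to \<open>a\<close>.\<close>

lemma two_gen_funpow:
  assumes I: "fractional_ideal K I" and \<O>: "a \<in> \<O>" "b \<in> \<O>" "u \<in> \<O>" "v \<in> \<O>"
    and quadratic: "b\<^sup>2 = t * b - a ^ n" and bezout: "u * a + v * t = 1" and "1 \<le> j" "j \<le> n"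
  shows "(two_gen a b ^^ j) I = two_gen (a ^ j) b I"
  using assms(8,9)
proof (induction j rule: nat_induct_at_least)
  case (Suc j)
  note closed = fractional_ideal_0[OF I] fractional_ideal_add[OF I] fractional_ideal_mult[OF I]
    \<O>_mult \<O>_power \<O>
  have "two_gen a b (two_gen (a ^ j) b I) = two_gen (a ^ Suc j) b I"
  proof (intro equalityI subsetI)
    fix z assume "z \<in> two_gen a b (two_gen (a ^ j) b I)"
    then obtain x y x' y' where z: "z = a * (a ^ j * x + b * y) + b * (a ^ j * x' + b * y')"
      and I': "x \<in> I" "y \<in> I" "x' \<in> I" "y' \<in> I"
      unfolding two_gen_def by blast
    have "z = a ^ Suc j * x + b * (a * y + a ^ j * x' + b * y')"
      unfolding z by (simp add: algebra_simps)
    moreover have "a * y + a ^ j * x' + b * y' \<in> I" using I' by (intro closed)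
    ultimately show "z \<in> two_gen (a ^ Suc j) b I" using I' unfolding two_gen_def by blast
  next
    fix z assume "z \<in> two_gen (a ^ Suc j) b I"
    then obtain x y where z: "z = a ^ Suc j * x + b * y" and I': "x \<in> I" "y \<in> I"
      unfolding two_gen_def by blast
    define e where "e = a ^ (n - Suc j)"
    have an: "a ^ n = a ^ Suc j * e"
      using Suc.prems by (simp add: e_def power_add [symmetric] del: power_Suc)
    \<comment> \<open>The first summand supplies a factor \<open>a\<close>. In the second,
      \<open>t * b = b\<^sup>2 + a ^ n\<close>, where \<open>a ^ n\<close> is a multiple of
      \<open>a ^ Suc j\<close> because \<open>Suc j \<le> n\<close>.\<close>
    have "b * y = (u * a + v * t) * b * y" using bezout by simp
    also have "\<dots> = a * (b * (u * y)) + v * (b\<^sup>2 + a ^ n) * y"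
      unfolding quadratic by (simp add: algebra_simps)
    finally have "z = a * (a ^ j * (x + (e * v) * y) + b * (u * y)) + b * (a ^ j * 0 + b * (v * y))"
      unfolding z an by (simp add: algebra_simps power2_eq_square)
    moreover have "x + (e * v) * y \<in> I" "u * y \<in> I" "0 \<in> I" "v * y \<in> I"
      using I' by (auto simp: e_def intro!: closed)
    ultimately show "z \<in> two_gen a b (two_gen (a ^ j) b I)" unfolding two_gen_def by blast
  qed
  thus ?case using Suc by simp
qed simp

text \<open>Meant for \<open>c = t - b\<close>, where \<open>b * c = a ^ n\<close>: the ideal
  \<open>(a ^ n, b)\<close> is then generated by \<open>b\<close> alone.\<close>

lemma two_gen_principal:
  assumes I: "fractional_ideal K I" and "c \<in> \<O>"
  shows "two_gen (b * c) b I = (*) b ` I"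
proof (intro equalityI subsetI)
  fix z assume "z \<in> two_gen (b * c) b I"
  then obtain x y where xy: "z = (b * c) * x + b * y" "x \<in> I" "y \<in> I" unfolding two_gen_def by blast
  hence "z = b * (c * x + y)" by (simp add: algebra_simps)
  moreover have "c * x + y \<in> I"
    using xy assms(2) by (intro fractional_ideal_add[OF I] fractional_ideal_mult[OF I])
  ultimately show "z \<in> (*) b ` I" by blast
next
  fix z assume "z \<in> (*) b ` I"
  then obtain y where "z = (b * c) * 0 + b * y" "y \<in> I" by auto
  thus "z \<in> two_gen (b * c) b I" using fractional_ideal_0[OF I] unfolding two_gen_def by blast
qed

text \<open>The \<open>n\<close>-th iterate of multiplication by \<open>(a, b)\<close> is scaling by
  \<open>b\<close>, which is trivial on classes, so some class is fixed. On a representative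
  \<open>I\<close> the multiplication is scaling by some \<open>x\<close>, hence \<open>b\<close>
  and \<open>x ^ n\<close> scale \<open>I\<close> to the same set. Both quotients then stabilize
  \<open>I\<close>.\<close>

lemma associated_to_power_if_not_dvd_class_number:
  assumes n: "Factorial_Ring.prime n" "\<not> n dvd class_number K"
    and \<O>: "a \<in> \<O>" "b \<in> \<O>" "u \<in> \<O>" "v \<in> \<O>" "t - b \<in> \<O>" and nz: "a \<noteq> 0" "b \<noteq> 0"
    and quadratic: "b\<^sup>2 = t * b - a ^ n" and bezout: "u * a + v * t = 1"
  obtains x where "x \<in> K" "x \<noteq> 0" "b / x ^ n \<in> \<O>" "x ^ n / b \<in> \<O>"
proof -
  define S where "S = ideal_class ` Collect (fractional_ideal K)"
  define f where "f = image (two_gen a b)"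
  have not_dvd: "\<not> n dvd card S" using n(2) by (simp add: class_number_eq S_def)
  have "n \<ge> 1" using n(1) prime_ge_1_nat by blast
  have bI: "(two_gen a b ^^ n) I = (*) b ` I" if I: "fractional_ideal K I" for I
  proof -
    have "a ^ n = b * (t - b)" using quadratic by (simp add: algebra_simps power2_eq_square)
    thus ?thesis
      using two_gen_funpow[OF I \<O>(1-4) quadratic bezout \<open>n \<ge> 1\<close>] two_gen_principal[OF I \<O>(5)] by simp
  qed
  have "\<exists>C\<in>S. f C = C"
  proof (rule ccontr)
    assume no_fix: "\<not> (\<exists>C\<in>S. f C = C)"
    have "n dvd card S"
    proof (rule prime_dvd_card_if_no_fixed_point[OF n(1)])
      \<comment> \<open>An infinite \<open>S\<close> would have cardinality 0, which
        \<open>n\<close> divides.\<close>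
      show "finite S" using not_dvd card.infinite by fastforce
      show "f C \<in> S" if "C \<in> S" for C
        using that fractional_ideal_two_gen \<O> nz by (auto simp: S_def f_def two_gen_ideal_class)
      show "f C \<noteq> C" if "C \<in> S" for C using no_fix that by blast
      fix C assume "C \<in> S"
      then obtain I where I: "fractional_ideal K I" "C = ideal_class I" by (auto simp: S_def)
      have "(f ^^ k) C = ideal_class ((two_gen a b ^^ k) I)" for k
        by (induction k) (simp_all add: I f_def two_gen_ideal_class)
      thus "(f ^^ n) C = C"
        using I nz \<O>_subset_K[OF \<O>(2)] by (simp add: bI ideal_class_scale)
    qed
    thus False using not_dvd by simp
  qed
  then obtain I where I: "fractional_ideal K I" "ideal_class (two_gen a b I) = ideal_class I"
    by (auto simp: S_def f_def two_gen_ideal_class)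
  hence "two_gen a b I \<in> ideal_class I" using mem_ideal_class_self by metis
  then obtain x where x: "x \<in> K" "x \<noteq> 0" "two_gen a b I = (*) x ` I"
    unfolding ideal_class_def by blast
  have "(two_gen a b ^^ k) I = (*) (x ^ k) ` I" for k
    by (induction k) (simp_all add: two_gen_scale x image_image mult.assoc mult.left_commute)
  hence eq: "(*) b ` I = (*) (x ^ n) ` I" using bI[OF I(1)] by simp
  have "b / x ^ n \<in> \<O>"
  proof (rule fractional_ideal_stabilizer[OF I(1)])
    show "b / x ^ n \<in> K" using x \<O>(2) by (simp add: K_divide K_power \<O>_subset_K)
    fix y assume "y \<in> I"
    hence "b * y \<in> (*) (x ^ n) ` I" using eq by blast
    thus "b / x ^ n * y \<in> I" using x by auto
  qed
  moreover have "x ^ n / b \<in> \<O>"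
  proof (rule fractional_ideal_stabilizer[OF I(1)])
    show "x ^ n / b \<in> K" using x \<O>(2) by (simp add: K_divide K_power \<O>_subset_K)
    fix y assume "y \<in> I"
    hence "x ^ n * y \<in> (*) b ` I" using eq by blast
    thus "x ^ n / b * y \<in> I" using nz by auto
  qed
  ultimately show thesis using that x by blast
qed

text \<open>A unit has norm 1, so its integral real part is 0 or a sign and \<open>w\<^sup>2\<close>
  is a sign. The value -1 does occur in this locale, namely when \<open>- D\<close> is a square and
  \<open>K\<close> contains the imaginary unit.\<close>

lemma unit_power_4:
  assumes "w \<in> \<O>" "inverse w \<in> \<O>" "w \<noteq> 0"
  shows "w ^ 4 = 1"
proof -
  obtain N N' :: int where N: "(cmod w)\<^sup>2 = of_int N" "(cmod (inverse w))\<^sup>2 = of_int N'"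
    using assms by (auto simp: mem_\<O>_iff elim!: Ints_cases)
  have "of_int (N * N') = (1::real)"
    using assms(3) by (simp add: N [symmetric] norm_inverse power_mult_distrib [symmetric])
  hence "N * N' = 1" by linarith
  moreover have "of_int N > (0::real)" using assms(3) by (simp add: N [symmetric])
  ultimately have "N = 1" by (auto simp: zmult_eq_1_iff)
  hence norm: "(Re w)\<^sup>2 + (Im w)\<^sup>2 = 1" using N(1) by (simp add: cmod_power2)
  obtain c where c: "Re w = of_int c" using assms(1) by (auto simp: mem_\<O>_iff elim: Ints_cases)
  have "(Re w)\<^sup>2 \<le> 1" using norm by (smt (verit) zero_le_power2)
  hence "c\<^sup>2 \<le> 1" unfolding c by (metis of_int_1 of_int_le_iff of_int_power)
  hence "\<bar>c\<bar> \<le> 1" by (simp add: abs_square_le_1)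
  hence "c = 0 \<or> c\<^sup>2 = 1" by (auto simp: abs_le_iff power2_eq_1_iff)
  hence "Re w = 0 \<or> (Re w)\<^sup>2 = 1" unfolding c by (metis of_int_0 of_int_1 of_int_power)
  hence "w\<^sup>2 = 1 \<or> w\<^sup>2 = -1"
  proof
    assume "Re w = 0"
    thus ?thesis using norm by (simp add: complex_eq_iff power2_eq_square)
  next
    assume Re: "(Re w)\<^sup>2 = 1"
    hence "Im w = 0" using norm by simp
    thus ?thesis using Re by (simp add: complex_eq_iff power2_eq_square)
  qed
  moreover have "w ^ 4 = (w\<^sup>2)\<^sup>2" by (simp flip: power_mult)
  ultimately show ?thesis by (metis power_one power2_minus)
qed

end

section \<open>The exceptional case\<close>

text \<open>If \<open>d\<close> has real part \<open>u \<noteq> 0\<close> and norm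
  \<open>2 * m\<close>, then \<open>lehmer m (u\<^sup>2) k\<close> is
  \<open>Re (d ^ (2 * k + 1)) / (2 ^ k * u)\<close>. This is the Lehmer number of index
  \<open>2 * k + 1\<close> for the pair \<open>d / sqrt 2\<close>,
  \<open>- cnj d / sqrt 2\<close>.\<close>

fun lehmer :: "int \<Rightarrow> int \<Rightarrow> nat \<Rightarrow> int" where
  "lehmer m q 0 = 1"
| "lehmer m q (Suc 0) = 2 * q - 3 * m"
| "lehmer m q (Suc (Suc k)) = (2 * q - 2 * m) * lehmer m q (Suc k) - m\<^sup>2 * lehmer m q k"

text \<open>The number \<open>g\<close> has trace \<open>2 * u\<^sup>2 - 2 * m\<close> and norm
  \<open>m\<^sup>2\<close>, so its quadratic equation is the recurrence of
  \<open>lehmer\<close>.\<close>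

lemma Re_eq_lehmer:
  assumes "d\<^sup>2 = 2 * g" "Re d = of_int u" "(cmod d)\<^sup>2 = 2 * of_int m"
  shows "Re (d * g ^ k) = of_int (u * lehmer m (u\<^sup>2) k)"
proof -
  define y where "y = Im d"
  have d: "d = Complex (of_int u) y" using assms(2) by (simp add: y_def complex_eq_iff)
  have norm: "y\<^sup>2 = 2 * of_int m - (of_int u)\<^sup>2"
    using assms(2,3) by (simp add: cmod_power2 y_def)
  have "g = d\<^sup>2 / 2" using assms(1) by simp
  hence "g = Complex (((of_int u)\<^sup>2 - y\<^sup>2) / 2) (of_int u * y)"
    by (simp add: d complex_eq_iff power2_eq_square)
  hence g: "g = Complex ((of_int u)\<^sup>2 - of_int m) (of_int u * y)" by (simp add: norm)
  have "((of_int u)\<^sup>2 - of_int m)\<^sup>2 + (of_int u * y)\<^sup>2 = (of_int m)\<^sup>2"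
    unfolding power_mult_distrib norm by (simp add: power2_eq_square algebra_simps)
  hence "g\<^sup>2 = of_int (2 * u\<^sup>2 - 2 * m) * g - of_int (m\<^sup>2)"
    by (simp add: g complex_eq_iff power2_eq_square) (simp add: algebra_simps)
  hence "d * g ^ k * g\<^sup>2 = d * g ^ k * (of_int (2 * u\<^sup>2 - 2 * m) * g - of_int (m\<^sup>2))" for k
    by simp
  hence rec: "d * g ^ Suc (Suc k) =
      of_int (2 * u\<^sup>2 - 2 * m) * (d * g ^ Suc k) - of_int (m\<^sup>2) * (d * g ^ k)" for k
    by (simp add: power2_eq_square right_diff_distrib mult_ac)
  show ?thesis
  proof (induction k rule: induct_nat_012)
    case 1
    have "Re (d * g ^ Suc 0) = of_int u * ((of_int u)\<^sup>2 - of_int m) - of_int u * y\<^sup>2"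
      by (simp add: d g power2_eq_square)
    thus ?case unfolding norm by (simp add: power2_eq_square algebra_simps)
  next
    case (ge2 k)
    have "Re (d * g ^ Suc (Suc k)) =
        of_int (2 * u\<^sup>2 - 2 * m) * Re (d * g ^ Suc k) - of_int (m\<^sup>2) * Re (d * g ^ k)"
      unfolding rec by simp
    also have "\<dots> = of_int (u * lehmer m (u\<^sup>2) (Suc (Suc k)))"
      unfolding ge2 by (simp add: algebra_simps)
    finally show ?case .
  qed (simp add: assms)
qed

text \<open>Modulo \<open>m\<^sup>2\<close> the recurrence multiplies by \<open>2 - 2 * m\<close>.
  If both terms were signs, the difference \<open>d\<close> would have absolute value between
  \<open>2 * m - 3\<close> and \<open>2 * m - 1\<close>, too small for a nonzero multiple of
  \<open>m\<^sup>2\<close>.\<close>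

lemma lehmer_not_consecutive_units:
  assumes "m \<ge> 3" "\<bar>lehmer m 1 (Suc i)\<bar> = 1"
  shows "\<bar>lehmer m 1 (Suc (Suc i))\<bar> \<noteq> 1"
proof
  assume unit: "\<bar>lehmer m 1 (Suc (Suc i))\<bar> = 1"
  define d where "d = (2 - 2 * m) * lehmer m 1 (Suc i) - lehmer m 1 (Suc (Suc i))"
  have "m\<^sup>2 dvd d" by (simp add: d_def)
  moreover have "d \<noteq> 0" "\<bar>d\<bar> \<le> 2 * m - 1"
    using assms unit unfolding d_def by (auto simp: abs_if split: if_splits)
  ultimately have "m\<^sup>2 \<le> 2 * m - 1"
    using dvd_imp_le_int[of d "m\<^sup>2"] by simp
  moreover have "3 * m \<le> m\<^sup>2" using assms(1) by (simp add: power2_eq_square)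
  ultimately show False using assms(1) by simp
qed

section \<open>From the class number to a term of the recurrence\<close>

lemma abs_lehmer_eq_1_if_not_dvd_class_number:
  fixes m :: int and n k :: nat
  assumes m: "m \<ge> 3" "odd m" and n: "Factorial_Ring.prime n" "n = 2 * k + 1"
    and not_dvd: "\<not> n dvd class_number (quadratic_field (1 - 2 * m ^ n))"
  shows "\<bar>lehmer m 1 k\<bar> = 1"
proof -
  define D where "D = 1 - 2 * m ^ n"
  have m_pos: "m ^ n > 0" using m(1) by simp
  interpret imaginary_quadratic D
  proof
    show "D < 0" using m_pos by (simp add: D_def)
    have "odd (m ^ n)" using m(2) by simp
    then obtain a where "m ^ n = 2 * a + 1" by (elim oddE)
    thus "D mod 4 = 3" unfolding D_def by presburger
  qed
  have rr: "r\<^sup>2 = 2 * of_int m ^ n - 1"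
    unfolding power2_eq_square r_square by (simp add: D_def)
  define \<alpha> where "\<alpha> = Complex 1 r"
  define \<beta> where "\<beta> = Complex (1 - of_int m ^ n) r"
  \<comment> \<open>Stated for both signs of the imaginary part, to cover \<open>\<beta>\<close> and
    its conjugate \<open>t - \<beta>\<close>.\<close>
  have conj: "\<beta>' \<in> \<O>" if "Re \<beta>' = 1 - of_int m ^ n" "Im \<beta>' = r \<or> Im \<beta>' = - r" for \<beta>'
  proof -
    have "Im \<beta>' * r \<in> \<rat>" using that(2) by (auto simp: r_square)
    thus ?thesis using that unfolding mem_\<O>_iff mem_K_iff cmod_power2 by (auto simp: rr)
  qed
  have \<beta>_\<O>: "\<beta> \<in> \<O>" by (rule conj) (simp_all add: \<beta>_def)
  have \<alpha>_K: "\<alpha> \<in> K" by (simp add: mem_K_iff \<alpha>_def r_square)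
  have \<beta>_nz: "\<beta> \<noteq> 0"
    using r_pos by (auto simp: \<beta>_def complex_eq_iff)
  have \<alpha>_\<beta>: "\<alpha>\<^sup>2 = 2 * \<beta>"
    using rr by (simp add: \<alpha>_def \<beta>_def complex_eq_iff power2_eq_square)
  have \<beta>_norm: "(cmod \<beta>)\<^sup>2 = (of_int m ^ n)\<^sup>2"
    by (simp add: \<beta>_def cmod_power2 rr) (simp add: power2_eq_square algebra_simps)
  define t where "t = 2 - 2 * m ^ n"
  \<comment> \<open>The trace \<open>t\<close> of \<open>\<beta>\<close> is 2 modulo
    \<open>m\<close>, and \<open>m\<close> is odd.\<close>
  have "coprime (m\<^sup>2) t"
  proof -
    have "coprime m t"
    proof (rule coprimeI)
      fix d assume d: "d dvd m" "d dvd t"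
      have "d dvd t + m * (2 * m ^ (2 * k))" using d by simp
      also have "t + m * (2 * m ^ (2 * k)) = 2" by (simp add: t_def n(2))
      finally show "is_unit d" using d(1) m(2) coprime_common_divisor[of m 2 d] by simp
    qed
    thus ?thesis by simp
  qed
  then obtain u v where uv: "u * m\<^sup>2 + v * t = 1"
    using bezout_int[of "m\<^sup>2" t] by auto
  \<comment> \<open>The choice of \<open>m\<^sup>2\<close> for \<open>a\<close> makes
    \<open>a ^ n\<close> the norm of \<open>\<beta>\<close>.\<close>
  obtain x where x: "x \<in> K" "x \<noteq> 0" "\<beta> / x ^ n \<in> \<O>" "x ^ n / \<beta> \<in> \<O>"
  proof (rule associated_to_power_if_not_dvd_class_number[where n = n and a = "of_int (m\<^sup>2)"
        and b = \<beta> and u = "of_int u" and v = "of_int v" and t = "of_int t"])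
    show "Factorial_Ring.prime n" "\<not> n dvd class_number K"
      using n(1) not_dvd by (simp_all add: D_def)
    show "of_int (m\<^sup>2) \<in> \<O>" "of_int u \<in> \<O>" "of_int v \<in> \<O>" by (rule \<O>_of_int)+
    show "of_int t - \<beta> \<in> \<O>"
      by (rule conj) (simp_all add: t_def \<beta>_def)
    show "of_int u * of_int (m\<^sup>2) + of_int v * of_int t = (1 :: complex)"
      using uv by (metis of_int_1 of_int_add of_int_mult)
    have "of_int (m\<^sup>2) ^ n = complex_of_real ((of_int m ^ n)\<^sup>2)"
      by (simp add: mult.commute flip: power_mult)
    moreover have "real_of_int t = 2 - 2 * of_int m ^ n" by (simp add: t_def)
    moreover have "r * r = 2 * of_int m ^ n - 1" using rr by (simp add: power2_eq_square)
    ultimately show "\<beta>\<^sup>2 = of_int t * \<beta> - of_int (m\<^sup>2) ^ n"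
      by (simp add: \<beta>_def complex_eq_iff power2_eq_square) (simp add: algebra_simps)
  qed (use \<beta>_\<O> \<beta>_nz m in auto)
  define w where "w = \<beta> / x ^ n"
  have "w ^ 4 = 1"
    using x \<beta>_nz by (intro unit_power_4) (simp_all add: w_def)
  \<comment> \<open>The unit \<open>w\<close> is itself the \<open>n\<close>-th power of
    \<open>w ^ n\<close>, because \<open>n * n\<close> is 1 modulo 4 and
    \<open>w ^ 4 = 1\<close>.\<close>
  define g where "g = w ^ n * x"
  have g_pow: "g ^ n = \<beta>"
  proof -
    have "g ^ n = w ^ (n * n) * x ^ n"
      by (simp add: g_def power_mult_distrib power_mult)
    also have "n * n = 4 * (k * k + k) + 1" by (simp add: n(2) algebra_simps)
    also have "w ^ (4 * (k * k + k) + 1) = w"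
      using \<open>w ^ 4 = 1\<close> by (simp add: power_add power_mult)
    finally show ?thesis using x by (simp add: w_def)
  qed
  have g_nz: "g \<noteq> 0" using g_pow \<beta>_nz n(2) by auto
  have "g \<in> K"
    using x \<O>_subset_K unfolding g_def w_def by (intro K_mult K_power)
  define \<delta> where "\<delta> = \<alpha> / g ^ k"
  have \<delta>_sq: "\<delta>\<^sup>2 = 2 * g"
  proof -
    have "\<delta>\<^sup>2 = 2 * g ^ n / g ^ (2 * k)"
      by (simp add: \<delta>_def power_divide \<alpha>_\<beta> g_pow mult.commute flip: power_mult)
    thus ?thesis using g_nz by (simp add: n(2))
  qed
  have "\<delta> \<in> \<O>"
  proof -
    \<comment> \<open>Dividing by \<open>g ^ k\<close> preserves integrality since
      \<open>\<delta> ^ (2 * n) = 2 ^ n * \<beta>\<close> is integral.\<close>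
    have "algebraic_int \<delta>"
    proof (rule algebraic_int_root)
      have "poly (monom 1 (2 * n)) \<delta> = (\<delta>\<^sup>2) ^ n" by (simp add: poly_monom power_mult)
      also have "\<dots> = of_int (2 ^ n) * \<beta>" by (simp add: \<delta>_sq power_mult_distrib g_pow)
      finally show "poly (monom 1 (2 * n)) \<delta> = of_int (2 ^ n) * \<beta>" .
      have "of_int (2 ^ n) * \<beta> \<in> \<O>" using \<beta>_\<O> by (intro \<O>_mult \<O>_of_int)
      thus "algebraic_int (of_int (2 ^ n) * \<beta>)" by (simp add: ring_of_integers_def)
    qed (use n(2) in \<open>auto simp: degree_monom_eq\<close>)
    moreover have "\<delta> \<in> K" using \<alpha>_K \<open>g \<in> K\<close> unfolding \<delta>_def by (intro K_divide K_power)
    ultimately show ?thesis by (simp add: ring_of_integers_def)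
  qed
  then obtain u where u: "Re \<delta> = of_int u" by (auto simp: mem_\<O>_iff elim: Ints_cases)
  have "((cmod g)\<^sup>2) ^ n = ((of_int m)\<^sup>2) ^ n"
    using \<beta>_norm by (simp add: g_pow [symmetric] norm_power mult.commute flip: power_mult)
  hence "(cmod g)\<^sup>2 = (of_int m)\<^sup>2"
    using n(2) by (subst (asm) power_eq_iff_eq_base) auto
  hence "cmod g = of_int m" using m(1) by (simp add: power2_eq_iff_nonneg)
  moreover have "(cmod \<delta>)\<^sup>2 = 2 * cmod g"
    using \<delta>_sq by (metis norm_mult norm_numeral norm_power)
  ultimately have \<delta>_norm: "(cmod \<delta>)\<^sup>2 = 2 * of_int m" by simp
  have "\<delta> * g ^ k = \<alpha>" using g_nz by (simp add: \<delta>_def)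
  with Re_eq_lehmer[OF \<delta>_sq u \<delta>_norm, of k] have "of_int (u * lehmer m (u\<^sup>2) k) = (1::real)"
    by (simp add: \<alpha>_def)
  hence eq: "u * lehmer m (u\<^sup>2) k = 1" by linarith
  hence "\<bar>u\<bar> = 1" "\<bar>lehmer m (u\<^sup>2) k\<bar> = 1" by (auto simp: zmult_eq_1_iff)
  moreover from this have "u\<^sup>2 = 1" by (metis power2_abs power_one)
  ultimately show ?thesis by simp
qed

theorem theorem10:
  fixes m :: int and p :: nat
  assumes "m \<ge> 3" and "odd m"
    and "Factorial_Ring.prime p" and "Factorial_Ring.prime (p + 2)"
  shows "p dvd class_number (quadratic_field (1 - 2 * m ^ p)) \<or>
         p + 2 dvd class_number (quadratic_field (1 - 2 * m ^ (p + 2)))"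
proof (rule ccontr)
  assume *: "\<not> ?thesis"
  have "p \<noteq> 2" using assms(4) by auto
  hence "odd p" using assms(3) primes_dvd_imp_eq two_is_prime_nat by blast
  then obtain k where k: "p = 2 * k + 1" by (elim oddE)
  \<comment> \<open>A positive \<open>k\<close> is what lets the recurrence relate the two terms:
    \<open>lehmer_not_consecutive_units\<close> starts at index 1.\<close>
  hence "k \<noteq> 0" using assms(3) by (intro notI) simp
  then obtain i where i: "k = Suc i" by (cases k) auto
  have "\<bar>lehmer m 1 (Suc i)\<bar> = 1"
    using abs_lehmer_eq_1_if_not_dvd_class_number[OF assms(1-3) k] * i by simp
  \<comment> \<open>As \<open>p + 2 = 2 * Suc k + 1\<close>, the larger prime belongs to the next
    index.\<close>
  moreover have "\<bar>lehmer m 1 (Suc (Suc i))\<bar> = 1"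
    using abs_lehmer_eq_1_if_not_dvd_class_number[OF assms(1,2,4), of "Suc k"] * i k by simp
  ultimately show False using lehmer_not_consecutive_units[OF assms(1)] by blast
qed

end
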